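(* Let $Q\in\mathcal{Q}_n$, let $k,l\in\{1,\dots,n\}$ with $k\le l$, and let $\hat y_{ab},\check y_{ab}$ be real numbers with $\check y_{ab}\le y^*_{ab}\le\hat y_{ab}$ for all relevant assignments $ab$ (all $ab\in\{00,01,10,11\}$ if $k\ne l$; $ab\in\{00,11\}$ if $k=l$). Define, if $k\neq l$, $$y^-:=\min\{0,\ \min\{\hat y_{00},\hat y_{01},\hat y_{10}\}-\check y_{11}\},\qquad y^+:=\max\{0,\ \min\{\check y_{00},\check y_{01},\check y_{10}\}-\hat y_{11}\},$$ and, if $k=l$, $$y^-:=\min\{0,\ \hat y_{00}-\check y_{11}\},\qquad y^+:=\max\{0,\ \check y_{00}-\hat y_{11}\}.$$ Let $w\in\mathbb{R}$ and let $Q'$ be the matrix obtained from $Q$ by replacing the entry $Q_{kl}$ with $Q_{kl}+w$. If $y^-\le w\le y^+$, then an optimum is preserved: there is a vector $x^*\in S^*(Q)$ with $x^*\in S^*(Q')$.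
   Context: $\mathcal{Q}_n$ denotes the set of all upper triangular matrices in $\mathbb{R}^{n\times n}$. For $Q\in\mathcal{Q}_n$, $f_Q:\{0,1\}^n\to\mathbb{R}$ is $f_Q(x)=x^\top Qx=\sum_{i=1}^n\sum_{j=i}^n Q_{ij}x_ix_j$, and $S^*(Q)$ is the set of vectors minimizing $f_Q$ over $\{0,1\}^n$. For fixed indices $k\le l$ and bits $a,b$ (with $a=b$ if $k=l$), $y^*_{ab}$ denotes the minimum of $f_Q(x)$ over all $x\in\{0,1\}^n$ with $x_k=a$ and $x_l=b$. *)

theory Defs
  imports "Jordan_Normal_Form.Matrix"
begin

(* Vectors and matrices are indexed from 0, so the index set is {0..<n} instead of {1..n}. *)

definition upper_triangular_mats :: "nat \<Rightarrow> real mat set" where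
  "upper_triangular_mats n = {Q \<in> carrier_mat n n. upper_triangular Q}"

definition binary_vecs :: "nat \<Rightarrow> real vec set" where
  "binary_vecs n = {x \<in> carrier_vec n. \<forall>i<n. x $ i \<in> {0, 1}}"

definition quad_form :: "real mat \<Rightarrow> real vec \<Rightarrow> real" where
  "quad_form Q x = x \<bullet> (Q *\<^sub>v x)"

definition minimizers :: "nat \<Rightarrow> real mat \<Rightarrow> real vec set" where
  "minimizers n Q =
     {x \<in> binary_vecs n. \<forall>y \<in> binary_vecs n. quad_form Q x \<le> quad_form Q y}"

definition restricted_vecs :: "nat \<Rightarrow> nat \<Rightarrow> nat \<Rightarrow> nat \<Rightarrow> nat \<Rightarrow> real vec set" where
  "restricted_vecs n k l a b = {x \<in> binary_vecs n. x $ k = real a \<and> x $ l = real b}"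

(* Only meant for k, l < n and bits a, b in {0, 1}, with a = b if k = l. Then the minimum is taken
   over a nonempty finite set; see finite_restricted_vecs and restricted_vecs_nonempty. *)
definition restricted_min :: "nat \<Rightarrow> real mat \<Rightarrow> nat \<Rightarrow> nat \<Rightarrow> nat \<Rightarrow> nat \<Rightarrow> real" where
  "restricted_min n Q k l a b = Min (quad_form Q ` restricted_vecs n k l a b)"

(* In the next two definitions, yu a b is the upper bound and yl a b the lower bound on the
   restricted minimum for the assignment a, b; for k = l the mixed assignments are not used. *)
definition y_minus :: "nat \<Rightarrow> nat \<Rightarrow> (nat \<Rightarrow> nat \<Rightarrow> real) \<Rightarrow> (nat \<Rightarrow> nat \<Rightarrow> real) \<Rightarrow> real" where
  "y_minus k l yu yl =
     (if k \<noteq> l then min 0 (Min {yu 0 0, yu 0 1, yu 1 0} - yl 1 1)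
      else min 0 (yu 0 0 - yl 1 1))"

definition y_plus :: "nat \<Rightarrow> nat \<Rightarrow> (nat \<Rightarrow> nat \<Rightarrow> real) \<Rightarrow> (nat \<Rightarrow> nat \<Rightarrow> real) \<Rightarrow> real" where
  "y_plus k l yu yl =
     (if k \<noteq> l then max 0 (Min {yl 0 0, yl 0 1, yl 1 0} - yu 1 1)
      else max 0 (yl 0 0 - yu 1 1))"

definition add_to_entry :: "real mat \<Rightarrow> nat \<Rightarrow> nat \<Rightarrow> real \<Rightarrow> real mat" where
  "add_to_entry Q k l w =
     mat (dim_row Q) (dim_col Q) (\<lambda>(i, j). if i = k \<and> j = l then Q $$ (k, l) + w else Q $$ (i, j))"

lemma quad_form_eq_sum:
  assumes "Q \<in> upper_triangular_mats n" "x \<in> carrier_vec n"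
  shows "quad_form Q x = (\<Sum>i<n. \<Sum>j=i..<n. Q $$ (i, j) * x $ i * x $ j)"
proof -
  have Q: "Q \<in> carrier_mat n n" and ut: "upper_triangular Q"
    using assms by (auto simp: upper_triangular_mats_def)
  have "quad_form Q x = (\<Sum>i<n. \<Sum>j<n. Q $$ (i, j) * x $ i * x $ j)"
    using Q assms(2)
    by (auto simp: quad_form_def scalar_prod_def sum_distrib_left atLeast0LessThan ac_simps
        intro!: sum.cong)
  also have "\<dots> = (\<Sum>i<n. \<Sum>j=i..<n. Q $$ (i, j) * x $ i * x $ j)"
  proof (rule sum.cong)
    fix i assume i: "i \<in> {..<n}"
    show "(\<Sum>j<n. Q $$ (i, j) * x $ i * x $ j) = (\<Sum>j=i..<n. Q $$ (i, j) * x $ i * x $ j)"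
      using i Q upper_triangularD[OF ut] by (intro sum.mono_neutral_right) auto
  qed simp
  finally show ?thesis .
qed

lemma finite_binary_vecs: "finite (binary_vecs n)"
proof (rule finite_subset)
  show "binary_vecs n \<subseteq> vec_of_list ` {xs. set xs \<subseteq> {0, 1} \<and> length xs = n}"
  proof
    fix x assume x: "x \<in> binary_vecs n"
    then have "set (list_of_vec x) \<subseteq> {0, 1}" "length (list_of_vec x) = n"
      by (auto simp: binary_vecs_def in_set_conv_nth list_of_vec_index)
    moreover have "x = vec_of_list (list_of_vec x)" by (simp add: vec_list)
    ultimately show "x \<in> vec_of_list ` {xs. set xs \<subseteq> {0, 1} \<and> length xs = n}" by blast
  qed
  show "finite (vec_of_list ` {xs. set xs \<subseteq> {0, 1 :: real} \<and> length xs = n})"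
    by (intro finite_imageI finite_lists_length_eq) simp
qed

lemma finite_restricted_vecs: "finite (restricted_vecs n k l a b)"
  using finite_binary_vecs[of n] by (simp add: restricted_vecs_def)

lemma restricted_vecs_nonempty:
  assumes "k < n" "l < n" "a \<in> {0, 1}" "b \<in> {0, 1}" "k = l \<longrightarrow> a = b"
  shows "restricted_vecs n k l a b \<noteq> {}"
proof -
  have "vec n (\<lambda>i. if i = k then real a else if i = l then real b else 0) \<in> restricted_vecs n k l a b"
    using assms by (auto simp: restricted_vecs_def binary_vecs_def)
  then show ?thesis by blast
qed

end

theory Submission
  imports Defs
begin

text \<open>
  On binary vectors, adding \<open>w\<close> to the entry \<open>(k, l)\<close> shifts the objective by \<open>w\<close> on the
  vectors with \<open>x $ k = x $ l = 1\<close> and changes nothing elsewhere. If \<open>w > 0\<close>, the upper bound on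
  \<open>w\<close> says that the best of these vectors stays at least as good as all others after the shift,
  so it is optimal before and after. If \<open>w < 0\<close>, the lower bound says that the best of the other
  vectors remains optimal although the vectors with two ones have become cheaper.
\<close>

lemma quad_form_add_to_entry:
  assumes Q: "Q \<in> upper_triangular_mats n" and k: "k \<le> l" "l < n" and x: "x \<in> carrier_vec n"
  shows "quad_form (add_to_entry Q k l w) x = quad_form Q x + w * x $ k * x $ l"
proof -
  have Qc: "Q \<in> carrier_mat n n" using Q by (simp add: upper_triangular_mats_def)
  \<comment> \<open>Since \<open>k \<le> l\<close>, the changed entry is on or above the diagonal,
    so the triangular sum formula applies to the new matrix too.\<close>
  have Q': "add_to_entry Q k l w \<in> upper_triangular_mats n"
    using Q k by (auto simp: upper_triangular_mats_def add_to_entry_def upper_triangular_def)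
  \<comment> \<open>The increment is written as a nested case split, on \<open>j\<close> outside and
    \<open>i\<close> inside, so that the inner and then the outer sum collapse to one term.\<close>
  have "quad_form (add_to_entry Q k l w) x =
      (\<Sum>i<n. \<Sum>j=i..<n. Q $$ (i, j) * x $ i * x $ j
         + (if j = l then if i = k then w * x $ k * x $ l else 0 else 0))"
    unfolding quad_form_eq_sum[OF Q' x] using Qc
    by (intro sum.cong refl) (auto simp: add_to_entry_def algebra_simps)
  also have "\<dots> = quad_form Q x
      + (\<Sum>i<n. \<Sum>j=i..<n. if j = l then if i = k then w * x $ k * x $ l else 0 else 0)"
    by (simp add: sum.distrib quad_form_eq_sum[OF Q x])
  also have "(\<Sum>i<n. \<Sum>j=i..<n. if j = l then if i = k then w * x $ k * x $ l else 0 else 0)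
      = (\<Sum>i<n. if i = k then w * x $ k * x $ l else 0)"
    using k by (intro sum.cong refl) (auto simp: sum.delta)
  also have "\<dots> = w * x $ k * x $ l" using k by simp
  finally show ?thesis .
qed

lemma restricted_min_le:
  "x \<in> restricted_vecs n k l a b \<Longrightarrow> restricted_min n Q k l a b \<le> quad_form Q x"
  by (simp add: restricted_min_def finite_restricted_vecs)

lemma restricted_min_attained:
  assumes "k < n" "l < n" "a \<in> {0, 1}" "b \<in> {0, 1}" "k = l \<longrightarrow> a = b"
  obtains x where "x \<in> restricted_vecs n k l a b" "quad_form Q x = restricted_min n Q k l a b"
proof -
  have "restricted_min n Q k l a b \<in> quad_form Q ` restricted_vecs n k l a b"
    unfolding restricted_min_def
    by (intro Min_in finite_imageI finite_restricted_vecs)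
       (use restricted_vecs_nonempty[OF assms] in blast)
  then show ?thesis using that by auto
qed

text \<open>The entries are real but assignments are natural numbers, so each entry is read back as
  a bit; for \<open>k = l\<close> both bits come from the same entry and agree.\<close>

lemma binary_vecs_cases:
  assumes "x \<in> binary_vecs n" "k < n" "l < n"
  obtains a b where "a \<in> {0, 1}" "b \<in> {0, 1}" "k = l \<longrightarrow> a = b" "x \<in> restricted_vecs n k l a b"
proof (rule that)
  let ?bit = "\<lambda>i. if x $ i = 1 then 1 else 0 :: nat"
  show "x \<in> restricted_vecs n k l (?bit k) (?bit l)"
    using assms by (auto simp: restricted_vecs_def binary_vecs_def)
qed auto

theorem theorem2:
  fixes n k l :: nat and Q :: "real mat" and yu yl :: "nat \<Rightarrow> nat \<Rightarrow> real" and w :: real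
  assumes "Q \<in> upper_triangular_mats n"
    and "k < n" and "l < n" and "k \<le> l"
    and "\<forall>a \<in> {0, 1}. \<forall>b \<in> {0, 1}. (k = l \<longrightarrow> a = b) \<longrightarrow>
           yl a b \<le> restricted_min n Q k l a b \<and> restricted_min n Q k l a b \<le> yu a b"
    and "y_minus k l yu yl \<le> w" and "w \<le> y_plus k l yu yl"
  shows "\<exists>x. x \<in> minimizers n Q \<and> x \<in> minimizers n (add_to_entry Q k l w)"
proof -
  let ?B = "binary_vecs n" and ?A = "restricted_vecs n k l 1 1"
  let ?f = "quad_form Q" and ?f' = "quad_form (add_to_entry Q k l w)"
  let ?M = "restricted_min n Q k l"
  \<comment> \<open>These are the assignments other than 11; for \<open>k = l\<close> only 00 is
    left.\<close>
  let ?valid = "\<lambda>a b. a \<in> {0, 1} \<and> b \<in> {0, 1} \<and> (k = l \<longrightarrow> a = b) \<and> \<not> (a = 1 \<and> b = (1::nat))"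
  have AB: "?A \<subseteq> ?B" by (auto simp: restricted_vecs_def)
  have shift: "?f' y = ?f y + w * y $ k * y $ l" if "y \<in> ?B" for y
    using quad_form_add_to_entry[OF assms(1,4,3)] that by (simp add: binary_vecs_def)
  have f'_A: "?f' y = ?f y + w" if "y \<in> ?A" for y
    using that AB shift[of y] by (auto simp: restricted_vecs_def)
  have f'_diff: "?f' y = ?f y" if "y \<in> ?B - ?A" for y
    using that shift[of y] assms(2,3) by (auto simp: restricted_vecs_def binary_vecs_def)
  have bounds: "yl a b \<le> ?M a b" "?M a b \<le> yu a b"
    if "a \<in> {0, 1}" "b \<in> {0, 1}" "k = l \<longrightarrow> a = b" for a b
    using assms(5) that by blast+
  have diff_cases: "\<exists>a b. ?valid a b \<and> y \<in> restricted_vecs n k l a b" if y: "y \<in> ?B - ?A" for y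
    using y binary_vecs_cases[of y n k l] assms(2,3) by (metis DiffD1 DiffD2)
  have diffI: "y \<in> ?B - ?A" if "?valid a b" "y \<in> restricted_vecs n k l a b" for a b y
    using that by (auto simp: restricted_vecs_def)
  have "\<exists>x. x \<in> ?B \<and> (\<forall>y\<in>?B. ?f x \<le> ?f y) \<and> (\<forall>y\<in>?B. ?f' x \<le> ?f' y)"
  proof (cases "w > 0")
    case True
    obtain x where x: "x \<in> ?A" "?f x = ?M 1 1"
      using restricted_min_attained[of k n l 1 1 Q] assms(2,3) by auto
    \<comment> \<open>As \<open>w > 0\<close>, the maximum in \<open>y_plus\<close> is not 0, so
      \<open>yu 1 1 + w \<le> yl a b\<close> for every such assignment.\<close>
    have gap: "?M 1 1 + w \<le> ?M a b" if "?valid a b" for a b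
      using that True assms(7) bounds[of a b] bounds[of 1 1]
      by (auto simp: y_plus_def split: if_splits)
    have gap': "?f x + w \<le> ?f y" if y: "y \<in> ?B - ?A" for y
      using diff_cases[OF y] gap restricted_min_le x by (metis order_trans)
    have x_le: "?f x \<le> ?f y" if "y \<in> ?A" for y
      using x restricted_min_le[OF that] by simp
    show ?thesis
    proof (intro exI conjI ballI)
      show "x \<in> ?B" using x AB by auto
      show "?f x \<le> ?f y" if "y \<in> ?B" for y
        using gap'[of y] x_le[of y] that True by (cases "y \<in> ?A") auto
      show "?f' x \<le> ?f' y" if "y \<in> ?B" for y
        using gap'[of y] x_le[of y] x that f'_A[of y] f'_diff[of y] f'_A[of x]
        by (cases "y \<in> ?A") auto
    qed
  next
    case False
    show ?thesis
    proof (cases "w = 0")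
      case True
      have "?B \<noteq> {}" using restricted_vecs_nonempty[of k n l 1 1] assms(2,3) AB by auto
      then obtain x where x: "x \<in> ?B" "\<forall>y\<in>?B. ?f x \<le> ?f y"
        using ex_is_arg_min_if_finite[OF finite_binary_vecs, of n ?f]
        by (auto simp: is_arg_min_linorder)
      with shift True show ?thesis by auto
    next
      case w: False
      \<comment> \<open>Here \<open>w < 0\<close>, so the minimum in \<open>y_minus\<close> is not
        0. One assignment suffices, because a single cheap vector outside \<open>?A\<close> already
        bounds the minimum there.\<close>
      have "\<exists>a b. ?valid a b \<and> ?M a b \<le> ?M 1 1 + w"
      proof (cases "k = l")
        case True
        then have "?M 0 0 \<le> ?M 1 1 + w"
          using False w assms(6) bounds[of 0 0] bounds[of 1 1] by (auto simp: y_minus_def)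
        then show ?thesis using True by auto
      next
        case kl: False
        \<comment> \<open>The required assignment is one whose upper bound attains this
          minimum.\<close>
        have "Min {yu 0 0, yu 0 1, yu 1 0} \<in> {yu 0 0, yu 0 1, yu 1 0}"
          by (intro Min_in) auto
        then have "\<exists>p\<in>{(0, 0), (0, 1), (1, 0)}. yu (fst p) (snd p) = Min {yu 0 0, yu 0 1, yu 1 0}"
          by auto
        then obtain p where p: "p \<in> {(0, 0), (0, 1), (1, 0)}"
          "yu (fst p) (snd p) = Min {yu 0 0, yu 0 1, yu 1 0}" by blast
        define a b where "a = fst p" and "b = snd p"
        have ab: "?valid a b" "yu a b = Min {yu 0 0, yu 0 1, yu 1 0}"
          using p kl by (auto simp: a_def b_def)
        then have "yu a b \<le> yl 1 1 + w"
          using False w kl assms(6) by (auto simp: y_minus_def)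
        then have "?M a b \<le> ?M 1 1 + w"
          using ab bounds[of a b] bounds[of 1 1] by auto
        then show ?thesis using ab by blast
      qed
      then obtain a b where ab: "?valid a b" "?M a b \<le> ?M 1 1 + w" by blast
      obtain z where z: "z \<in> restricted_vecs n k l a b" "?f z = ?M a b"
        using restricted_min_attained[of k n l a b Q] ab assms(2,3) by blast
      have zD: "z \<in> ?B - ?A" using diffI[OF ab(1) z(1)] .
      \<comment> \<open>The vector \<open>z\<close> is best only for its own assignment, so the
        witness minimizes over all of \<open>?B - ?A\<close>; \<open>z\<close> shows this set
        nonempty and bounds its minimum.\<close>
      then obtain x where x: "x \<in> ?B - ?A" "\<forall>y\<in>?B - ?A. ?f x \<le> ?f y"
        using ex_is_arg_min_if_finite[of "?B - ?A" ?f] finite_binary_vecs[of n]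
        by (auto simp: is_arg_min_linorder)
      have gap: "?f x \<le> ?f y + w" if "y \<in> ?A" for y
        using bspec[OF x(2) zD] z(2) ab(2) restricted_min_le[OF that, of Q] by linarith
      show ?thesis
      proof (intro exI conjI ballI)
        show "x \<in> ?B" using x by simp
        \<comment> \<open>On \<open>?A\<close>, \<open>gap\<close> is even stronger than needed,
          because \<open>w\<close> is negative.\<close>
        show "?f x \<le> ?f y" if "y \<in> ?B" for y
          using gap[of y] x(2) that False by (cases "y \<in> ?A") auto
        show "?f' x \<le> ?f' y" if "y \<in> ?B" for y
          using gap[of y] x that f'_A[of y] f'_diff[of y] f'_diff[of x]
          by (cases "y \<in> ?A") auto
      qed
    qed
  qed
  then show ?thesis by (auto simp: minimizers_def)
qed

end
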